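(* Let real parameters $a_i,b_i,c_j$ ($i=1,\dots,6$, $j=1,2,3$) be such that $$\begin{aligned} r={}&a_1 D\wedge P+a_2 D\wedge H+a_3 P\wedge M+a_4 H\wedge M+a_5 P\wedge H+a_6 P\wedge C\\ &+b_1 D\wedge K+b_2 D\wedge C+b_3 K\wedge M+b_4 C\wedge M+b_5 K\wedge C+b_6 K\wedge H\\ &+c_1 D\wedge M+c_2 P\wedge K+c_3 H\wedge C\end{aligned}$$ is a classical $r$-matrix on the extended Schrödinger algebra $\mathcal S$ (i.e. it satisfies the modified classical Yang–Baxter equation). Then the Poisson–Lie structure defined by $r$ through the Sklyanin bracket on the extended Schrödinger group, in the local coordinates $(m,p,k,h,c,d)$ given by $g=e^{mM}e^{pP}e^{kK}e^{hH}e^{cC}e^{dD}$, is given by the following Poisson brackets: $\{d,h\}=a_2(e^{-2d}-1)+b_2h^2-c_3h$ $\{d,p\}=a_1(e^{-d}(1-ch)-1)+a_2k+a_5c\,e^{-3d}(1-ch)-a_6h-b_1he^{d}+b_2hp-b_6hc\,e^{-d}+c_3hk$ $\{d,k\}=a_1c\,e^{-d}+a_5c^2e^{-3d}+b_1(e^d-1)-b_2(p+hk)-b_5h+b_6c\,e^{-d}$ $\{d,c\}=-a_2c^2e^{-2d}+b_2(e^{2d}-1)-c_3c$ $\{h,p\}=2a_1h-a_2(p+2hk)+a_5(1-e^{-3d}(1-ch))+a_6h^2-b_2ph^2+b_6he^{-d}-c_3kh^2$ $\{h,k\}=a_2k-a_5c\,e^{-3d}+2b_1h+b_2h(2p+hk)+b_5h^2+b_6(1-e^{-d})-c_3p$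 $\{h,c\}=2a_2c+2b_2h(1-ch)+2c_3hc$ $\{p,k\}=a_1k-a_2k^2-a_6p+b_1p+b_2p^2-b_6k+c_3kp$ $\{p,c\}=2a_1c-2a_2kc-a_5c^2e^{-3d}(1-ch)+a_6(e^d(1-ch)-1+2ch)+b_2p(1-2ch)-b_5he^{3d}+b_6hc^2e^{-d}+c_3k(1-2ch)$ $\{k,c\}=-a_5c^3e^{-3d}+a_6c\,e^d+2b_1c-b_2(k(1-2ch)-2cp)+b_5(e^{3d}-1+2ch)-b_6c^2e^{-d}$ $\{m,d\}=-a_1ke^{-d}(1-ch)-\tfrac12a_2k^2+a_4c\,e^{-2d}-a_5kc\,e^{-3d}(1-ch)+b_1(p+hke^d)+\tfrac12b_2p^2-b_4h+b_5hp+b_6hkc\,e^{-d}-\tfrac12c_3hk^2$ $\{m,h\}=a_2hk^2+a_4(1-e^{-2d})+a_5ke^{-3d}(1-ch)-2b_1hp-b_2hp^2+b_4h^2-b_5ph^2-b_6(p+hke^{-d})-2c_1h+\tfrac12c_3(p^2+h^2k^2)$ $\{m,p\}=\tfrac12a_2pk^2+a_3(1-e^{-d}(1-ch))-a_4k-\tfrac12a_5k^2+\tfrac12a_6p^2-b_1p^2-\tfrac12b_2p^3+b_3he^d+b_6kp-c_1p+c_2p-\tfrac12c_3kp^2$ $\{m,k\}=-\tfrac12a_2k^3-a_3c\,e^{-d}+b_1kp+\tfrac12b_2kp^2-b_3(e^d-1)+b_4p-\tfrac12b_5p^2-\tfrac12b_6k^2+c_1k+c_2k+\tfrac12c_3pk^2$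 $\{m,c\}=-a_2ck^2+a_4c^2e^{-2d}-a_5kc^2e^{-3d}(1-ch)+a_6ke^d(1-ch)+2b_1cp+b_2cp^2-b_4(e^{2d}-1+2ch)-b_5(hke^{3d}+p(1-2ch))+b_6hkc^2e^{-d}+2c_1c+\tfrac12c_3k^2(1-2ch)$.
   Context: $\mathcal S$ is the real Lie algebra with basis $\{D,H,P,K,C,M\}$ and brackets $[D,P]=-P$, $[D,K]=K$, $[K,P]=M$, $[D,H]=-2H$, $[D,C]=2C$, $[H,C]=D$, $[K,H]=P$, $[K,C]=0$, $[P,C]=-K$, $[P,H]=0$, $[M,\cdot]=0$. It has the faithful $4\times4$ representation (with $E_{ij}$ the matrix units) $H=E_{23}$, $P=E_{13}+E_{24}$, $K=E_{12}-E_{34}$, $D=-E_{22}+E_{33}$, $C=-E_{32}$, $M=2E_{14}$; the extended Schrödinger group is the corresponding matrix group, and $g=e^{mM}e^{pP}e^{kK}e^{hH}e^{cC}e^{dD}$ gives local coordinates $(m,p,k,h,c,d)\in\mathbb R^6$ near the identity. (Here $c$ without index is a group coordinate, while $c_1,c_2,c_3$ are parameters.) Convention: $X\wedge Y=X\otimes Y-Y\otimes X$. The Schouten bracket of $r=r^{ij}X_i\otimes X_j$ is $[[r,r]]=[r_{12},r_{13}]+[r_{12},r_{23}]+[r_{13},r_{23}]$, and the modified classical Yang–Baxter equation is $[X\otimes1\otimes1+1\otimes X\otimes1+1\otimes1\otimes X,[[r,r]]]=0$ for all $X\in\mathcal S$. The Sklyanin bracket defined by $r=\sum r^{ij}X_i\otimes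 X_j$ is $\{f,f'\}=\sum_{i,j}r^{ij}(X_i^Lf\,X_j^Lf'-X_i^Rf\,X_j^Rf')$, where $X^L$ is the left-invariant vector field $(X^Lf)(g)=\frac{d}{dt}\big|_{0}f(g\,e^{tX})$ and $X^R$ the right-invariant vector field $(X^Rf)(g)=\frac{d}{dt}\big|_{0}f(e^{tX}g)$. *)

theory Defs
  imports "HOL-Analysis.Analysis"
begin

section \<open>The extended Schroedinger algebra\<close>

datatype gen = gD | gH | gP | gK | gC | gM

lemma UNIV_gen: "(UNIV :: gen set) = {gD, gH, gP, gK, gC, gM}"
  using gen.exhaust by auto

instance gen :: finite
  by standard (simp add: UNIV_gen)

text \<open>Elements of the Lie algebra, of its tensor square and of its tensor cube are given by their
  coordinates in the basis \<open>D, H, P, K, C, M\<close> and in the induced bases of the tensor powers.\<close>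

type_synonym schr = "real ^ gen"
type_synonym schr2 = "real ^ gen ^ gen"
type_synonym schr3 = "real ^ gen ^ gen ^ gen"

definition X :: "gen \<Rightarrow> schr" where
  "X i = axis i 1"

abbreviation "D \<equiv> X gD"
abbreviation "H \<equiv> X gH"
abbreviation "P \<equiv> X gP"
abbreviation "K \<equiv> X gK"
abbreviation "C \<equiv> X gC"
abbreviation "M \<equiv> X gM"

text \<open>The table of non-zero brackets, each unordered pair of generators being listed once;
  \<open>lie_gen\<close> is its antisymmetric extension.\<close>

fun lie_table :: "gen \<Rightarrow> gen \<Rightarrow> schr" where
  "lie_table gD gP = - P"
| "lie_table gD gK = K"
| "lie_table gK gP = M"
| "lie_table gD gH = - 2 *\<^sub>R H"
| "lie_table gD gC = 2 *\<^sub>R C"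
| "lie_table gH gC = D"
| "lie_table gK gH = P"
| "lie_table gP gC = - K"
| "lie_table _ _ = 0"

definition lie_gen :: "gen \<Rightarrow> gen \<Rightarrow> schr" where
  "lie_gen i j = lie_table i j - lie_table j i"

definition lie :: "schr \<Rightarrow> schr \<Rightarrow> schr" where
  "lie x y = (\<Sum>i\<in>UNIV. \<Sum>j\<in>UNIV. (x $ i * y $ j) *\<^sub>R lie_gen i j)"


section \<open>Tensors and the modified classical Yang--Baxter equation\<close>

definition tensor2 :: "schr \<Rightarrow> schr \<Rightarrow> schr2" where
  "tensor2 x y = (\<chi> i j. x $ i * y $ j)"

definition tensor3 :: "schr \<Rightarrow> schr \<Rightarrow> schr \<Rightarrow> schr3" where
  "tensor3 x y z = (\<chi> i j k. x $ i * y $ j * z $ k)"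

definition wedge :: "schr \<Rightarrow> schr \<Rightarrow> schr2" where
  "wedge x y = tensor2 x y - tensor2 y x"

text \<open>The three summands are \<open>[r12, r13]\<close>, \<open>[r12, r23]\<close> and \<open>[r13, r23]\<close>. They are commutators in
  the tensor cube of the enveloping algebra, but lie in the tensor cube of the Lie algebra,
  e.g. \<open>[X\<^sub>i \<otimes> X\<^sub>j \<otimes> 1, X\<^sub>k \<otimes> 1 \<otimes> X\<^sub>l] = [X\<^sub>i, X\<^sub>k] \<otimes> X\<^sub>j \<otimes> X\<^sub>l\<close>.\<close>

definition schouten :: "schr2 \<Rightarrow> schr3" where
  "schouten r =
     (\<Sum>i\<in>UNIV. \<Sum>j\<in>UNIV. \<Sum>k\<in>UNIV. \<Sum>l\<in>UNIV. (r $ i $ j * r $ k $ l) *\<^sub>R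
        tensor3 (lie (X i) (X k)) (X j) (X l))
   + (\<Sum>i\<in>UNIV. \<Sum>j\<in>UNIV. \<Sum>k\<in>UNIV. \<Sum>l\<in>UNIV. (r $ i $ j * r $ k $ l) *\<^sub>R
        tensor3 (X i) (lie (X j) (X k)) (X l))
   + (\<Sum>i\<in>UNIV. \<Sum>j\<in>UNIV. \<Sum>k\<in>UNIV. \<Sum>l\<in>UNIV. (r $ i $ j * r $ k $ l) *\<^sub>R
        tensor3 (X i) (X k) (lie (X j) (X l)))"

text \<open>\<open>ad3 x T = [x \<otimes> 1 \<otimes> 1 + 1 \<otimes> x \<otimes> 1 + 1 \<otimes> 1 \<otimes> x, T]\<close>\<close>

definition ad3 :: "schr \<Rightarrow> schr3 \<Rightarrow> schr3" where
  "ad3 x T = (\<Sum>i\<in>UNIV. \<Sum>j\<in>UNIV. \<Sum>k\<in>UNIV. (T $ i $ j $ k) *\<^sub>R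
     (tensor3 (lie x (X i)) (X j) (X k)
      + tensor3 (X i) (lie x (X j)) (X k)
      + tensor3 (X i) (X j) (lie x (X k))))"

definition classical_r_matrix :: "schr2 \<Rightarrow> bool" where
  "classical_r_matrix r \<longleftrightarrow> (\<forall>x. ad3 x (schouten r) = 0)"


section \<open>The matrix representation and the matrix group\<close>

type_synonym mat4 = "real ^ 4 ^ 4"

definition E :: "4 \<Rightarrow> 4 \<Rightarrow> mat4" where
  "E i j = (\<chi> a b. if a = i \<and> b = j then 1 else 0)"

fun rep_gen :: "gen \<Rightarrow> mat4" where
  "rep_gen gD = - E 2 2 + E 3 3"
| "rep_gen gH = E 2 3"
| "rep_gen gP = E 1 3 + E 2 4"
| "rep_gen gK = E 1 2 - E 3 4"
| "rep_gen gC = - E 3 2"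
| "rep_gen gM = 2 *\<^sub>R E 1 4"

definition rep :: "schr \<Rightarrow> mat4" where
  "rep x = (\<Sum>i\<in>UNIV. (x $ i) *\<^sub>R rep_gen i)"

text \<open>The matrix exponential as a power series. The library function \<open>exp\<close> is not available here,
  since the library multiplication \<open>*\<close> of \<open>mat4\<close> is componentwise.\<close>

definition mexp :: "mat4 \<Rightarrow> mat4" where
  "mexp A = (\<Sum>n. (1 / fact n) *\<^sub>R (((**) A) ^^ n) (mat 1))"

text \<open>The connected matrix group with this Lie algebra.\<close>

inductive_set ext_schr_group :: "mat4 set" where
  mexp_rep: "mexp (rep x) \<in> ext_schr_group"
| mult: "g \<in> ext_schr_group \<Longrightarrow> g' \<in> ext_schr_group \<Longrightarrow> g ** g' \<in> ext_schr_group"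

fun chart :: "real \<times> real \<times> real \<times> real \<times> real \<times> real \<Rightarrow> mat4" where
  "chart (m, p, k, h, c, d) =
     mexp (rep (m *\<^sub>R M)) ** mexp (rep (p *\<^sub>R P)) ** mexp (rep (k *\<^sub>R K)) **
     mexp (rep (h *\<^sub>R H)) ** mexp (rep (c *\<^sub>R C)) ** mexp (rep (d *\<^sub>R D))"

text \<open>The coordinate functions; they are meaningful on \<open>range chart\<close>, where \<open>inv chart\<close> is the
  inverse of the chart (see \<open>inj_chart\<close> below).\<close>

definition coord_m :: "mat4 \<Rightarrow> real" where
  "coord_m g = (case inv chart g of (m, p, k, h, c, d) \<Rightarrow> m)"
definition coord_p :: "mat4 \<Rightarrow> real" where
  "coord_p g = (case inv chart g of (m, p, k, h, c, d) \<Rightarrow> p)"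
definition coord_k :: "mat4 \<Rightarrow> real" where
  "coord_k g = (case inv chart g of (m, p, k, h, c, d) \<Rightarrow> k)"
definition coord_h :: "mat4 \<Rightarrow> real" where
  "coord_h g = (case inv chart g of (m, p, k, h, c, d) \<Rightarrow> h)"
definition coord_c :: "mat4 \<Rightarrow> real" where
  "coord_c g = (case inv chart g of (m, p, k, h, c, d) \<Rightarrow> c)"
definition coord_d :: "mat4 \<Rightarrow> real" where
  "coord_d g = (case inv chart g of (m, p, k, h, c, d) \<Rightarrow> d)"


section \<open>Invariant vector fields and the Sklyanin bracket\<close>

text \<open>Functions on the group are represented by functions on all matrices. For \<open>g\<close> in
  \<open>ext_schr_group\<close> the values below depend on the restriction to the group only.\<close>

definition left_field :: "schr \<Rightarrow> (mat4 \<Rightarrow> real) \<Rightarrow> mat4 \<Rightarrow> real" where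
  "left_field x f g = deriv (\<lambda>t. f (g ** mexp (t *\<^sub>R rep x))) 0"

definition right_field :: "schr \<Rightarrow> (mat4 \<Rightarrow> real) \<Rightarrow> mat4 \<Rightarrow> real" where
  "right_field x f g = deriv (\<lambda>t. f (mexp (t *\<^sub>R rep x) ** g)) 0"

definition sklyanin :: "schr2 \<Rightarrow> (mat4 \<Rightarrow> real) \<Rightarrow> (mat4 \<Rightarrow> real) \<Rightarrow> mat4 \<Rightarrow> real" where
  "sklyanin r f f' g = (\<Sum>i\<in>UNIV. \<Sum>j\<in>UNIV. r $ i $ j *
     (left_field (X i) f g * left_field (X j) f' g
      - right_field (X i) f g * right_field (X j) f' g))"


section \<open>Consistency of the definitions\<close>

lemma sum_gen: "(\<Sum>i\<in>UNIV. f i) = f gD + f gH + f gP + f gK + f gC + f gM"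
  for f :: "gen \<Rightarrow> 'a::comm_monoid_add"
  by (simp add: UNIV_gen add.assoc)

lemma all_gen: "(\<forall>i. Q i) \<longleftrightarrow> Q gD \<and> Q gH \<and> Q gP \<and> Q gK \<and> Q gC \<and> Q gM"
  by (metis gen.exhaust)

lemma X_nth: "X i $ j = (if j = i then 1 else 0)"
  by (simp add: X_def axis_def)

lemmas mat4_simps = vec_eq_iff forall_4 matrix_matrix_mult_def sum_4 E_def mat_def

lemma rep_lie_gen: "rep (lie_gen i j) = rep_gen i ** rep_gen j - rep_gen j ** rep_gen i"
  by (cases i; cases j)
    (simp_all add: lie_gen_def rep_def sum_gen X_nth mat4_simps)

lemma rep_X: "rep (X i) = rep_gen i"
  by (cases i) (simp_all add: rep_def sum_gen X_nth)

lemma rep_scaleR: "rep (t *\<^sub>R x) = t *\<^sub>R rep x"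
  by (simp add: rep_def scaleR_sum_right)

lemma rep_linear: "linear rep"
  by (rule linearI) (simp_all add: rep_scaleR, simp add: rep_def scaleR_add_left sum.distrib)

lemma lie_X: "lie (X i) (X j) = lie_gen i j"
proof -
  have "lie (X i) (X j) = (\<Sum>a\<in>UNIV. \<Sum>b\<in>UNIV. if b = j then (if a = i then lie_gen a b else 0) else 0)"
    unfolding lie_def by (intro sum.cong refl) (simp add: X_nth)
  then show ?thesis
    by simp
qed

lemma rep_lie: "rep (lie x y) = rep x ** rep y - rep y ** rep x"
proof -
  have "rep (lie x y) = (\<Sum>i\<in>UNIV. \<Sum>j\<in>UNIV. (x $ i * y $ j) *\<^sub>R rep (lie_gen i j))"
    by (simp add: lie_def linear_sum[OF rep_linear] rep_scaleR)
  also have "\<dots> = rep x ** rep y - rep y ** rep x"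
    unfolding rep_lie_gen
    by (simp add: rep_def sum_gen mat4_simps algebra_simps)
  finally show ?thesis .
qed

lemma inj_rep: "inj rep"
proof (rule injI)
  fix x y assume "rep x = rep y"
  then show "x = y"
    by (simp add: rep_def sum_gen mat4_simps all_gen)
qed

lemma mexp_square_zero:
  assumes "A ** A = 0"
  shows "mexp A = mat 1 + A"
proof -
  have z: "(((**) A) ^^ n) (mat 1) = 0" if "n \<ge> 2" for n
    using that
  proof (induction n rule: nat_induct_at_least)
    case base
    then show ?case using assms by (simp add: numeral_2_eq_2)
  next
    case (Suc n)
    then show ?case by (simp add: matrix_matrix_mult_def vec_eq_iff)
  qed
  have "mexp A = (\<Sum>n<2. (1 / fact n) *\<^sub>R (((**) A) ^^ n) (mat 1))"
    unfolding mexp_def by (rule suminf_finite) (auto simp: z)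
  then show ?thesis by (simp add: numeral_2_eq_2)
qed

definition diag4 :: "real \<Rightarrow> real \<Rightarrow> mat4" where
  "diag4 u v = E 1 1 + u *\<^sub>R E 2 2 + v *\<^sub>R E 3 3 + E 4 4"

lemma mexp_D: "mexp (t *\<^sub>R rep D) = diag4 (exp (- t)) (exp t)"
proof -
  let ?A = "t *\<^sub>R rep D"
  have pow: "(((**) ?A) ^^ n) (mat 1) =
      (0 ^ n) *\<^sub>R (E 1 1 + E 4 4) + ((- t) ^ n) *\<^sub>R E 2 2 + (t ^ n) *\<^sub>R E 3 3" for n
    by (induction n) (simp_all add: rep_X mat4_simps)
  have exps: "(\<lambda>n. (1 / fact n) * s ^ n) sums exp s" for s :: real
    using exp_converges[of s] by (simp add: field_simps)
  have s: "(\<lambda>n. ((1 / fact n) * 0 ^ n) *\<^sub>R (E 1 1 + E 4 4) + ((1 / fact n) * (- t) ^ n) *\<^sub>R E 2 2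
      + ((1 / fact n) * t ^ n) *\<^sub>R E 3 3) sums
      (exp 0 *\<^sub>R (E 1 1 + E 4 4) + exp (- t) *\<^sub>R E 2 2 + exp t *\<^sub>R E 3 3)"
    by (intro sums_add sums_scaleR_left exps)
  have "mexp ?A = exp 0 *\<^sub>R (E 1 1 + E 4 4) + exp (- t) *\<^sub>R E 2 2 + exp t *\<^sub>R E 3 3"
    unfolding mexp_def pow
    by (rule sums_unique[symmetric]) (use s in \<open>simp only: scaleR_add_right scaleR_scaleR\<close>)
  then show ?thesis
    by (simp add: diag4_def algebra_simps)
qed

lemma mexp_nilpotent:
  assumes "i \<noteq> gD"
  shows "mexp (t *\<^sub>R rep (X i)) = mat 1 + t *\<^sub>R rep_gen i"
  unfolding rep_X
  by (rule mexp_square_zero, use assms in \<open>cases i\<close>) (simp_all add: mat4_simps)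

lemma chart_eq:
  "chart (m, p, k, h, c, d) =
     (mat 1 + m *\<^sub>R rep_gen gM) ** (mat 1 + p *\<^sub>R rep_gen gP) ** (mat 1 + k *\<^sub>R rep_gen gK) **
     (mat 1 + h *\<^sub>R rep_gen gH) ** (mat 1 + c *\<^sub>R rep_gen gC) ** diag4 (exp (- d)) (exp d)"
  by (simp add: rep_scaleR mexp_nilpotent mexp_D)

lemma chart_entries:
  fixes m p k h c d :: real
  defines "g \<equiv> chart (m, p, k, h, c, d)"
  shows "g $ 3 $ 3 = exp d" "g $ 3 $ 2 = - c * exp (- d)" "g $ 2 $ 3 = h * exp d"
    "g $ 3 $ 4 = - k" "g $ 2 $ 4 = p" "g $ 1 $ 4 = 2 * m - p * k"
  unfolding g_def chart_eq by (simp_all add: mat4_simps diag4_def algebra_simps)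

lemma inj_chart: "inj chart"
proof (rule injI)
  fix x y assume eq: "chart x = chart y"
  obtain m p k h c d where x: "x = (m, p, k, h, c, d)" by (cases x)
  obtain m' p' k' h' c' d' where y: "y = (m', p', k', h', c', d')" by (cases y)
  note E = eq[unfolded x y]
  have "d = d'" "k = k'" "p = p'"
    using arg_cong[OF E, of "\<lambda>g. g $ 3 $ 3"] arg_cong[OF E, of "\<lambda>g. g $ 3 $ 4"]
      arg_cong[OF E, of "\<lambda>g. g $ 2 $ 4"] by (simp_all add: chart_entries del: chart.simps)
  moreover from this have "c = c'" "h = h'" "m = m'"
    using arg_cong[OF E, of "\<lambda>g. g $ 3 $ 2"] arg_cong[OF E, of "\<lambda>g. g $ 2 $ 3"]
      arg_cong[OF E, of "\<lambda>g. g $ 1 $ 4"] by (simp_all add: chart_entries del: chart.simps)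
  ultimately show "x = y" by (simp add: x y)
qed

lemma chart_in_group: "chart x \<in> ext_schr_group"
  by (cases x) (auto intro!: ext_schr_group.intros)

lemma chart_zero: "chart (0, 0, 0, 0, 0, 0) = mat 1"
  unfolding chart_eq by (simp add: mat4_simps diag4_def)

end

theory Submission
  imports Defs
begin

text \<open>The translates \<open>g e\<^sup>t\<^sup>X\<close> and \<open>e\<^sup>t\<^sup>X g\<close> of a point of the chart stay in the chart for small
  \<open>t\<close>, because the chart covers the part \<open>g\<^sub>3\<^sub>3 > 0\<close> of the group cut out by a symplectic form and
  two fixed vectors. On the chart the coordinates are rational functions (and one logarithm) of
  the matrix entries, so the invariant fields are read off the matrices \<open>g X\<close> and \<open>X g\<close>, and the
  fifteen brackets become identities in the coordinates and \<open>e\<^sup>d\<close>.\<close>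

definition symplectic_form :: mat4 where
  "symplectic_form = E 1 4 - E 4 1 + E 2 3 - E 3 2"

definition schr_stabilizer :: "mat4 set" where
  "schr_stabilizer = {g. transpose g ** symplectic_form ** g = symplectic_form \<and>
     g *v axis 1 1 = axis 1 1 \<and> axis 4 1 v* g = axis 4 1}"

lemma schr_stabilizer_mult:
  assumes "g \<in> schr_stabilizer" "g' \<in> schr_stabilizer"
  shows "g ** g' \<in> schr_stabilizer"
proof -
  have "transpose (g ** g') ** symplectic_form ** (g ** g')
      = transpose g' ** (transpose g ** symplectic_form ** g) ** g'"
    by (simp add: matrix_transpose_mul matrix_mul_assoc)
  moreover have "(g ** g') *v axis 1 1 = g *v (g' *v axis 1 1)"
    by (simp add: matrix_vector_mul_assoc)
  moreover have "axis 4 1 v* (g ** g') = (axis 4 1 v* g) v* g'"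
    by (simp add: vector_matrix_mul_assoc)
  ultimately show ?thesis
    using assms by (simp add: schr_stabilizer_def)
qed

lemmas stabilizer_simps = schr_stabilizer_def symplectic_form_def mat4_simps transpose_def
  matrix_vector_mult_def vector_matrix_mult_def axis_def

lemma mexp_X_in_stabilizer: "mexp (t *\<^sub>R rep (X i)) \<in> schr_stabilizer"
proof (cases "i = gD")
  case True
  have "diag4 (exp (- t)) (exp t) \<in> schr_stabilizer"
    by (simp add: stabilizer_simps diag4_def flip: exp_add)
  then show ?thesis
    using True by (simp add: mexp_D)
next
  case False
  then have "mat 1 + t *\<^sub>R rep_gen i \<in> schr_stabilizer"
    by (cases i) (simp_all add: stabilizer_simps)
  then show ?thesis
    using False by (simp add: mexp_nilpotent)
qed

lemma chart_in_stabilizer: "chart (m, p, k, h, c, d) \<in> schr_stabilizer"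
  by (simp add: rep_scaleR schr_stabilizer_mult mexp_X_in_stabilizer)

lemma stabilizer_eqI:
  assumes "g \<in> schr_stabilizer" "g' \<in> schr_stabilizer" "g $ 3 $ 3 \<noteq> 0"
    and "g $ 3 $ 3 = g' $ 3 $ 3" "g $ 3 $ 2 = g' $ 3 $ 2" "g $ 2 $ 3 = g' $ 2 $ 3"
    "g $ 3 $ 4 = g' $ 3 $ 4" "g $ 2 $ 4 = g' $ 2 $ 4" "g $ 1 $ 4 = g' $ 1 $ 4"
  shows "g = g'"
proof -
  have entries: "x $ 1 $ 1 = 1 \<and> x $ 2 $ 1 = 0 \<and> x $ 3 $ 1 = 0 \<and> x $ 4 $ 1 = 0
      \<and> x $ 4 $ 2 = 0 \<and> x $ 4 $ 3 = 0 \<and> x $ 4 $ 4 = 1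
      \<and> x $ 2 $ 2 * x $ 3 $ 3 = 1 + x $ 2 $ 3 * x $ 3 $ 2
      \<and> x $ 1 $ 2 = x $ 3 $ 2 * x $ 2 $ 4 - x $ 2 $ 2 * x $ 3 $ 4
      \<and> x $ 1 $ 3 = x $ 3 $ 3 * x $ 2 $ 4 - x $ 2 $ 3 * x $ 3 $ 4"
    if "x \<in> schr_stabilizer" for x
    using that by (clarsimp simp: stabilizer_simps algebra_simps)
  note e = entries[OF assms(1)] entries[OF assms(2)]
  have "g $ 2 $ 2 * g $ 3 $ 3 = g' $ 2 $ 2 * g $ 3 $ 3"
    using e assms by simp
  then have "g $ 2 $ 2 = g' $ 2 $ 2"
    using assms by simp
  then show ?thesis
    using e assms by (simp add: vec_eq_iff forall_4)
qed

lemma chart_of_entries: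
  assumes "g \<in> schr_stabilizer" "g $ 3 $ 3 > 0"
  shows "g = chart ((g $ 1 $ 4 - g $ 2 $ 4 * g $ 3 $ 4) / 2, g $ 2 $ 4, - g $ 3 $ 4,
    g $ 2 $ 3 / g $ 3 $ 3, - g $ 3 $ 2 * g $ 3 $ 3, ln (g $ 3 $ 3))"
  using assms by (intro stabilizer_eqI chart_in_stabilizer)
    (simp_all add: chart_entries exp_minus field_simps del: chart.simps)

lemma coords_of_entries:
  assumes "g \<in> schr_stabilizer" "g $ 3 $ 3 > 0"
  shows "coord_m g = (g $ 1 $ 4 - g $ 2 $ 4 * g $ 3 $ 4) / 2"
    "coord_p g = g $ 2 $ 4" "coord_k g = - g $ 3 $ 4" "coord_h g = g $ 2 $ 3 / g $ 3 $ 3"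
    "coord_c g = - g $ 3 $ 2 * g $ 3 $ 3" "coord_d g = ln (g $ 3 $ 3)"
proof -
  have "inv chart g = ((g $ 1 $ 4 - g $ 2 $ 4 * g $ 3 $ 4) / 2, g $ 2 $ 4, - g $ 3 $ 4,
    g $ 2 $ 3 / g $ 3 $ 3, - g $ 3 $ 2 * g $ 3 $ 3, ln (g $ 3 $ 3))"
    using chart_of_entries[OF assms] inv_f_f[OF inj_chart] by metis
  then show "coord_m g = (g $ 1 $ 4 - g $ 2 $ 4 * g $ 3 $ 4) / 2"
    "coord_p g = g $ 2 $ 4" "coord_k g = - g $ 3 $ 4" "coord_h g = g $ 2 $ 3 / g $ 3 $ 3"
    "coord_c g = - g $ 3 $ 2 * g $ 3 $ 3" "coord_d g = ln (g $ 3 $ 3)"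
    by (simp_all add: coord_m_def coord_p_def coord_k_def coord_h_def coord_c_def coord_d_def)
qed

lemma deriv_coords_curve:
  fixes \<gamma> :: "real \<Rightarrow> mat4"
  assumes stab: "\<And>t. \<gamma> t \<in> schr_stabilizer"
    and pos: "\<gamma> 0 $ 3 $ 3 > 0"
    and der: "\<And>i j. ((\<lambda>t. \<gamma> t $ i $ j) has_real_derivative A $ i $ j) (at 0)"
  shows
    "deriv (\<lambda>t. coord_m (\<gamma> t)) 0
       = (A $ 1 $ 4 - A $ 2 $ 4 * \<gamma> 0 $ 3 $ 4 - \<gamma> 0 $ 2 $ 4 * A $ 3 $ 4) / 2"
    "deriv (\<lambda>t. coord_p (\<gamma> t)) 0 = A $ 2 $ 4"
    "deriv (\<lambda>t. coord_k (\<gamma> t)) 0 = - A $ 3 $ 4"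
    "deriv (\<lambda>t. coord_h (\<gamma> t)) 0
       = (A $ 2 $ 3 * \<gamma> 0 $ 3 $ 3 - \<gamma> 0 $ 2 $ 3 * A $ 3 $ 3) / (\<gamma> 0 $ 3 $ 3)\<^sup>2"
    "deriv (\<lambda>t. coord_c (\<gamma> t)) 0 = - (A $ 3 $ 2 * \<gamma> 0 $ 3 $ 3 + \<gamma> 0 $ 3 $ 2 * A $ 3 $ 3)"
    "deriv (\<lambda>t. coord_d (\<gamma> t)) 0 = A $ 3 $ 3 / \<gamma> 0 $ 3 $ 3"
proof -
  have "\<forall>\<^sub>F t in at 0. \<gamma> t $ 3 $ 3 > 0"
    by (rule order_tendstoD(1)[OF _ pos]) (rule DERIV_isCont[OF der, unfolded isCont_def])
  then have ev: "\<forall>\<^sub>F t in nhds 0. \<gamma> t $ 3 $ 3 > 0"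
    using pos by (simp add: eventually_nhds_conv_at)
  have eq: "deriv (\<lambda>t. f (\<gamma> t)) 0 = D"
    if "\<And>t. \<gamma> t $ 3 $ 3 > 0 \<Longrightarrow> f (\<gamma> t) = F t"
      and "(F has_real_derivative D) (at 0)" for f F D
  proof -
    have "\<forall>\<^sub>F t in nhds 0. f (\<gamma> t) = F t"
      using ev by eventually_elim (rule that(1))
    then show ?thesis
      using that(2) by (intro DERIV_imp_deriv) (simp add: DERIV_cong_ev)
  qed
  note coords = coords_of_entries[OF stab]
  show "deriv (\<lambda>t. coord_m (\<gamma> t)) 0
       = (A $ 1 $ 4 - A $ 2 $ 4 * \<gamma> 0 $ 3 $ 4 - \<gamma> 0 $ 2 $ 4 * A $ 3 $ 4) / 2"
    by (rule eq, erule coords) (auto intro!: derivative_eq_intros der)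
  show "deriv (\<lambda>t. coord_p (\<gamma> t)) 0 = A $ 2 $ 4"
    by (rule eq, erule coords) (rule der)
  show "deriv (\<lambda>t. coord_k (\<gamma> t)) 0 = - A $ 3 $ 4"
    by (rule eq, erule coords) (auto intro!: derivative_eq_intros der)
  show "deriv (\<lambda>t. coord_h (\<gamma> t)) 0
       = (A $ 2 $ 3 * \<gamma> 0 $ 3 $ 3 - \<gamma> 0 $ 2 $ 3 * A $ 3 $ 3) / (\<gamma> 0 $ 3 $ 3)\<^sup>2"
    using pos by (intro eq, erule_tac coords)
      (auto intro!: derivative_eq_intros der simp: power2_eq_square)
  show "deriv (\<lambda>t. coord_c (\<gamma> t)) 0 = - (A $ 3 $ 2 * \<gamma> 0 $ 3 $ 3 + \<gamma> 0 $ 3 $ 2 * A $ 3 $ 3)"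
    by (rule eq, erule coords) (auto intro!: derivative_eq_intros der)
  show "deriv (\<lambda>t. coord_d (\<gamma> t)) 0 = A $ 3 $ 3 / \<gamma> 0 $ 3 $ 3"
    using pos by (intro eq, erule_tac coords) (auto intro!: derivative_eq_intros der)
qed

lemma mexp_X_zero: "mexp (0 *\<^sub>R rep (X i)) = mat 1"
  by (simp add: mexp_square_zero)

lemma mexp_X_entry_deriv:
  "((\<lambda>t. mexp (t *\<^sub>R rep (X n)) $ i $ j) has_real_derivative rep_gen n $ i $ j) (at 0)"
proof (cases "n = gD")
  case True
  have "((\<lambda>t. diag4 (exp (- t)) (exp t) $ i $ j) has_real_derivative (- E 2 2 + E 3 3) $ i $ j) (at 0)"
    unfolding diag4_def
    by (auto simp: E_def intro!: derivative_eq_intros)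
  then show ?thesis
    using True by (simp add: mexp_D)
next
  case False
  then show ?thesis
    by (auto simp: mexp_nilpotent mat_def intro!: derivative_eq_intros)
qed

lemma left_translate_entry_deriv:
  "((\<lambda>t. (g ** mexp (t *\<^sub>R rep (X n))) $ i $ j) has_real_derivative
     (g ** rep_gen n) $ i $ j) (at 0)"
  unfolding matrix_matrix_mult_def vec_lambda_beta
  by (intro DERIV_sum DERIV_cmult mexp_X_entry_deriv)

lemma right_translate_entry_deriv:
  "((\<lambda>t. (mexp (t *\<^sub>R rep (X n)) ** g) $ i $ j) has_real_derivative
     (rep_gen n ** g) $ i $ j) (at 0)"
  unfolding matrix_matrix_mult_def vec_lambda_beta
  by (intro DERIV_sum DERIV_cmult_right mexp_X_entry_deriv)

context
  fixes g :: mat4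
  assumes g_stab: "g \<in> schr_stabilizer" and g_pos: "g $ 3 $ 3 > 0"
begin

lemmas left_field_coords =
  deriv_coords_curve[OF schr_stabilizer_mult[OF g_stab mexp_X_in_stabilizer] _
    left_translate_entry_deriv, unfolded mexp_X_zero matrix_mul_rid, OF g_pos,
    folded left_field_def]

lemmas right_field_coords =
  deriv_coords_curve[OF schr_stabilizer_mult[OF mexp_X_in_stabilizer g_stab] _
    right_translate_entry_deriv, unfolded mexp_X_zero matrix_mul_lid, OF g_pos,
    folded right_field_def]

end

lemma sklyanin_wedge:
  "sklyanin (wedge (X i) (X j)) f f' g =
     left_field (X i) f g * left_field (X j) f' g - left_field (X j) f g * left_field (X i) f' g
     - (right_field (X i) f g * right_field (X j) f' g
        - right_field (X j) f g * right_field (X i) f' g)"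
proof -
  define G where "G a b = left_field (X a) f g * left_field (X b) f' g
      - right_field (X a) f g * right_field (X b) f' g" for a b
  have pick: "(\<Sum>a\<in>UNIV. \<Sum>b\<in>UNIV. X i $ a * X j $ b * G a b) = G i j" for i j
  proof -
    have "(\<Sum>a\<in>UNIV. \<Sum>b\<in>UNIV. X i $ a * X j $ b * G a b)
        = (\<Sum>a\<in>UNIV. \<Sum>b\<in>UNIV. if b = j then (if a = i then G a b else 0) else 0)"
      by (intro sum.cong refl) (simp add: X_nth)
    then show ?thesis
      by simp
  qed
  have "sklyanin (wedge (X i) (X j)) f f' g
      = (\<Sum>a\<in>UNIV. \<Sum>b\<in>UNIV. X i $ a * X j $ b * G a b - X j $ a * X i $ b * G a b)"
    unfolding sklyanin_def G_def[symmetric]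
    by (simp add: wedge_def tensor2_def left_diff_distrib)
  also have "\<dots> = G i j - G j i"
    by (simp only: sum_subtractf pick)
  finally show ?thesis
    by (simp add: G_def)
qed

lemma sklyanin_add: "sklyanin (r + s) f f' g = sklyanin r f f' g + sklyanin s f f' g"
  by (simp add: sklyanin_def distrib_right sum.distrib)

lemma sklyanin_scaleR: "sklyanin (a *\<^sub>R r) f f' g = a * sklyanin r f f' g"
  by (simp add: sklyanin_def sum_distrib_left mult.assoc)

lemma exp_multiples:
  fixes d :: real
  shows "exp (- d) = 1 / exp d" "exp (- 2 * d) = 1 / exp d ^ 2" "exp (- 3 * d) = 1 / exp d ^ 3"
    "exp (2 * d) = exp d ^ 2" "exp (3 * d) = exp d ^ 3"
  by (simp_all add: exp_minus inverse_eq_divide flip: exp_of_nat_mult)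

context
  fixes m p k h c d :: real and g :: mat4
  assumes g: "g = chart (m, p, k, h, c, d)"
begin

lemma chart_rows:
  "g $ 1 $ 1 = 1" "g $ 1 $ 2 = (k * (1 - c * h) - c * p) / exp d"
  "g $ 1 $ 3 = (p + h * k) * exp d" "g $ 1 $ 4 = 2 * m - p * k"
  "g $ 2 $ 1 = 0" "g $ 2 $ 2 = (1 - c * h) / exp d" "g $ 2 $ 3 = h * exp d" "g $ 2 $ 4 = p"
  "g $ 3 $ 1 = 0" "g $ 3 $ 2 = - c / exp d" "g $ 3 $ 3 = exp d" "g $ 3 $ 4 = - k"
  "g $ 4 $ 1 = 0" "g $ 4 $ 2 = 0" "g $ 4 $ 3 = 0" "g $ 4 $ 4 = 1"
  unfolding g chart_eq exp_multiples
  by (simp_all add: mat4_simps diag4_def algebra_simps add_divide_distrib diff_divide_distrib)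

lemma chart_stab_pos: "g \<in> schr_stabilizer" "g $ 3 $ 3 > 0"
  by (simp_all add: chart_rows, simp only: g chart_in_stabilizer)

lemma left_field_chart:
  "left_field (X i) coord_m g = (case i of gP \<Rightarrow> k * (1 - c * h) / exp d
     | gK \<Rightarrow> - h * k * exp d | gM \<Rightarrow> 1 | _ \<Rightarrow> 0)"
  "left_field (X i) coord_p g = (case i of gP \<Rightarrow> (1 - c * h) / exp d | gK \<Rightarrow> - h * exp d | _ \<Rightarrow> 0)"
  "left_field (X i) coord_k g = (case i of gP \<Rightarrow> c / exp d | gK \<Rightarrow> exp d | _ \<Rightarrow> 0)"
  "left_field (X i) coord_h g = (case i of gH \<Rightarrow> 1 / exp d ^ 2 | _ \<Rightarrow> 0)"
  "left_field (X i) coord_c g = (case i of gH \<Rightarrow> - (c ^ 2) / exp d ^ 2 | gC \<Rightarrow> exp d ^ 2 | _ \<Rightarrow> 0)"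
  "left_field (X i) coord_d g = (case i of gD \<Rightarrow> 1 | gH \<Rightarrow> - c / exp d ^ 2 | _ \<Rightarrow> 0)"
  by (cases i; simp add: left_field_coords[OF chart_stab_pos] matrix_matrix_mult_def sum_4 E_def
      chart_rows field_simps power2_eq_square)+

lemma right_field_chart:
  "right_field (X i) coord_m g = (case i of gH \<Rightarrow> - (k ^ 2) / 2 | gK \<Rightarrow> p | gC \<Rightarrow> p ^ 2 / 2
     | gM \<Rightarrow> 1 | _ \<Rightarrow> 0)"
  "right_field (X i) coord_p g = (case i of gD \<Rightarrow> - p | gH \<Rightarrow> - k | gP \<Rightarrow> 1 | _ \<Rightarrow> 0)"
  "right_field (X i) coord_k g = (case i of gD \<Rightarrow> k | gK \<Rightarrow> 1 | gC \<Rightarrow> p | _ \<Rightarrow> 0)"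
  "right_field (X i) coord_h g = (case i of gD \<Rightarrow> - 2 * h | gH \<Rightarrow> 1 | gC \<Rightarrow> h ^ 2 | _ \<Rightarrow> 0)"
  "right_field (X i) coord_c g = (case i of gD \<Rightarrow> 2 * c | gC \<Rightarrow> 1 - 2 * c * h | _ \<Rightarrow> 0)"
  "right_field (X i) coord_d g = (case i of gD \<Rightarrow> 1 | gC \<Rightarrow> - h | _ \<Rightarrow> 0)"
  by (cases i; simp add: right_field_coords[OF chart_stab_pos] matrix_matrix_mult_def sum_4 E_def
      chart_rows field_simps power2_eq_square)+

end

theorem mainTheorem2:
  fixes a1 a2 a3 a4 a5 a6 b1 b2 b3 b4 b5 b6 c1 c2 c3 :: real
    and m p k h c d :: real
    and r :: schr2 and g :: mat4
  assumes r: "r =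
      a1 *\<^sub>R wedge D P + a2 *\<^sub>R wedge D H + a3 *\<^sub>R wedge P M
    + a4 *\<^sub>R wedge H M + a5 *\<^sub>R wedge P H + a6 *\<^sub>R wedge P C
    + b1 *\<^sub>R wedge D K + b2 *\<^sub>R wedge D C + b3 *\<^sub>R wedge K M
    + b4 *\<^sub>R wedge C M + b5 *\<^sub>R wedge K C + b6 *\<^sub>R wedge K H
    + c1 *\<^sub>R wedge D M + c2 *\<^sub>R wedge P K + c3 *\<^sub>R wedge H C"
    and "classical_r_matrix r"
    and g: "g = chart (m, p, k, h, c, d)"
  shows
    "sklyanin r coord_d coord_h g =
       a2 * (exp (-2*d) - 1) + b2 * h^2 - c3 * h
   \<and> sklyanin r coord_d coord_p g =
       a1 * (exp (-d) * (1 - c*h) - 1) + a2 * k + a5 * c * exp (-3*d) * (1 - c*h) - a6 * h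
       - b1 * h * exp d + b2 * h * p - b6 * h * c * exp (-d) + c3 * h * k
   \<and> sklyanin r coord_d coord_k g =
       a1 * c * exp (-d) + a5 * c^2 * exp (-3*d) + b1 * (exp d - 1) - b2 * (p + h*k)
       - b5 * h + b6 * c * exp (-d)
   \<and> sklyanin r coord_d coord_c g =
       - a2 * c^2 * exp (-2*d) + b2 * (exp (2*d) - 1) - c3 * c
   \<and> sklyanin r coord_h coord_p g =
       2 * a1 * h - a2 * (p + 2*h*k) + a5 * (1 - exp (-3*d) * (1 - c*h)) + a6 * h^2
       - b2 * p * h^2 + b6 * h * exp (-d) - c3 * k * h^2
   \<and> sklyanin r coord_h coord_k g =
       a2 * k - a5 * c * exp (-3*d) + 2 * b1 * h + b2 * h * (2*p + h*k) + b5 * h^2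
       + b6 * (1 - exp (-d)) - c3 * p
   \<and> sklyanin r coord_h coord_c g =
       2 * a2 * c + 2 * b2 * h * (1 - c*h) + 2 * c3 * h * c
   \<and> sklyanin r coord_p coord_k g =
       a1 * k - a2 * k^2 - a6 * p + b1 * p + b2 * p^2 - b6 * k + c3 * k * p
   \<and> sklyanin r coord_p coord_c g =
       2 * a1 * c - 2 * a2 * k * c - a5 * c^2 * exp (-3*d) * (1 - c*h)
       + a6 * (exp d * (1 - c*h) - 1 + 2*c*h) + b2 * p * (1 - 2*c*h) - b5 * h * exp (3*d)
       + b6 * h * c^2 * exp (-d) + c3 * k * (1 - 2*c*h)
   \<and> sklyanin r coord_k coord_c g =
       - a5 * c^3 * exp (-3*d) + a6 * c * exp d + 2 * b1 * c
       - b2 * (k * (1 - 2*c*h) - 2*c*p) + b5 * (exp (3*d) - 1 + 2*c*h) - b6 * c^2 * exp (-d)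
   \<and> sklyanin r coord_m coord_d g =
       - a1 * k * exp (-d) * (1 - c*h) - 1/2 * a2 * k^2 + a4 * c * exp (-2*d)
       - a5 * k * c * exp (-3*d) * (1 - c*h) + b1 * (p + h * k * exp d) + 1/2 * b2 * p^2
       - b4 * h + b5 * h * p + b6 * h * k * c * exp (-d) - 1/2 * c3 * h * k^2
   \<and> sklyanin r coord_m coord_h g =
       a2 * h * k^2 + a4 * (1 - exp (-2*d)) + a5 * k * exp (-3*d) * (1 - c*h)
       - 2 * b1 * h * p - b2 * h * p^2 + b4 * h^2 - b5 * p * h^2
       - b6 * (p + h * k * exp (-d)) - 2 * c1 * h + 1/2 * c3 * (p^2 + h^2 * k^2)
   \<and> sklyanin r coord_m coord_p g =
       1/2 * a2 * p * k^2 + a3 * (1 - exp (-d) * (1 - c*h)) - a4 * k - 1/2 * a5 * k^2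
       + 1/2 * a6 * p^2 - b1 * p^2 - 1/2 * b2 * p^3 + b3 * h * exp d + b6 * k * p
       - c1 * p + c2 * p - 1/2 * c3 * k * p^2
   \<and> sklyanin r coord_m coord_k g =
       - 1/2 * a2 * k^3 - a3 * c * exp (-d) + b1 * k * p + 1/2 * b2 * k * p^2
       - b3 * (exp d - 1) + b4 * p - 1/2 * b5 * p^2 - 1/2 * b6 * k^2
       + c1 * k + c2 * k + 1/2 * c3 * p * k^2
   \<and> sklyanin r coord_m coord_c g =
       - a2 * c * k^2 + a4 * c^2 * exp (-2*d) - a5 * k * c^2 * exp (-3*d) * (1 - c*h)
       + a6 * k * exp d * (1 - c*h) + 2 * b1 * c * p + b2 * c * p^2
       - b4 * (exp (2*d) - 1 + 2*c*h) - b5 * (h * k * exp (3*d) + p * (1 - 2*c*h))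
       + b6 * h * k * c^2 * exp (-d) + 2 * c1 * c + 1/2 * c3 * k^2 * (1 - 2*c*h)"
proof -
  define u where "u = exp d"
  have u: "u \<noteq> 0"
    by (simp add: u_def)
  note bracket = r sklyanin_add sklyanin_scaleR sklyanin_wedge left_field_chart[OF g]
    right_field_chart[OF g] gen.case exp_multiples u_def[symmetric]
  show ?thesis
    unfolding bracket
    by (intro conjI; simp add: field_simps power2_eq_square power3_eq_cube u)
qed

end
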